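(* Let $\theta$ be any real number, and let $X$ be a real random variable with distribution function $F$. (1) Let $q>1$. If $X$ is $q$-subweibull with radius of convergence $R_q$, then the exponentially tilted variable $Z\sim F_\theta$ is also $q$-subweibull and has the same radius of convergence $R_q$. (2) Let $q\geq 1$. If $X$ is strictly $q$-subweibull, then the exponentially tilted variable $Z\sim F_\theta$ is also strictly $q$-subweibull. (3) Let $q>1$. If $X$ is not $q$-subweibull and $\mathbb{E}[\exp(\theta X)]<\infty$ (so that $F_\theta$ is defined), then $Z\sim F_\theta$ is also not $q$-subweibull.
   Context: For $q>0$, a real random variable $X$ is $q$-subweibull if $\mathbb{E}[\exp(\lambda^q|X|^q)]<\infty$ for some $\lambda>0$; it is strictly $q$-subweibull if this holds for all $\lambda>0$. The radius of convergence is $R_q=\sup\{\lambda>0:\mathbb{E}[\exp(\lambda^q|X|^q)]<\infty\}\in[0,\infty]$, with $R_q=0$ if no such $\lambda$ exists. The two-sided Laplace transform of $X$ is $\mathcal{L}_X(t)=\mathbb{E}[\exp(-tX)]\in(0,\infty]$. If $\mathcal{L}_X(-\theta)=\mathbb{E}[\exp(\theta X)]<\infty$, the exponentially tilted distribution is $$F_\theta(x)=\int_{-\infty}^x\frac{\exp(\theta t)}{\mathcal{L}_X(-\theta)}\,dF(t),$$ with $F_0=F$. In parts (1) and (2), asserting a property of $Z\sim F_\theta$ for every real $\theta$ includes that $\mathcal{L}_X(-\theta)<\infty$, i.e. that $F_\theta$ is well defined. *)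

theory Defs
  imports "HOL-Probability.Probability"
begin

text \<open>Expectations that may be infinite are taken in \<^typ>\<open>ennreal\<close>.\<close>

definition weibull_moment :: "'a measure \<Rightarrow> real \<Rightarrow> ('a \<Rightarrow> real) \<Rightarrow> real \<Rightarrow> ennreal" where
  "weibull_moment M q X l = (\<integral>\<^sup>+ \<omega>. ennreal (exp (l powr q * \<bar>X \<omega>\<bar> powr q)) \<partial>M)"

definition subweibull :: "'a measure \<Rightarrow> real \<Rightarrow> ('a \<Rightarrow> real) \<Rightarrow> bool" where
  "subweibull M q X \<longleftrightarrow> (\<exists>l>0. weibull_moment M q X l < \<infinity>)"

definition strictly_subweibull :: "'a measure \<Rightarrow> real \<Rightarrow> ('a \<Rightarrow> real) \<Rightarrow> bool" where
  "strictly_subweibull M q X \<longleftrightarrow> (\<forall>l>0. weibull_moment M q X l < \<infinity>)"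

text \<open>The supremum of the empty set is 0 in \<^typ>\<open>ennreal\<close>, as required when no \<open>l\<close> exists.\<close>

definition weibull_radius :: "'a measure \<Rightarrow> real \<Rightarrow> ('a \<Rightarrow> real) \<Rightarrow> ennreal" where
  "weibull_radius M q X = Sup {ennreal l | l. l > 0 \<and> weibull_moment M q X l < \<infinity>}"

definition laplace :: "'a measure \<Rightarrow> ('a \<Rightarrow> real) \<Rightarrow> real \<Rightarrow> ennreal" where
  "laplace M X t = (\<integral>\<^sup>+ \<omega>. ennreal (exp (- t * X \<omega>)) \<partial>M)"

text \<open>The distribution function \<open>F\<^sub>\<theta>\<close>; integration against \<open>dF\<close> is integration with
  respect to the law of \<open>X\<close>. It is meaningful only if \<open>laplace M X (- \<theta>) < \<infinity>\<close>.\<close>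

definition tilted_cdf :: "'a measure \<Rightarrow> ('a \<Rightarrow> real) \<Rightarrow> real \<Rightarrow> real \<Rightarrow> real" where
  "tilted_cdf M X \<theta> x =
     (LINT t:{..x}|distr M borel X. exp (\<theta> * t) / enn2real (laplace M X (- \<theta>)))"

text \<open>\<open>Z \<sim> F\<^sub>\<theta>\<close>, where \<open>Z\<close> may live on a probability space \<open>N\<close> other than that of \<open>X\<close>.\<close>

definition has_tilted_law ::
    "'b measure \<Rightarrow> ('b \<Rightarrow> real) \<Rightarrow> 'a measure \<Rightarrow> ('a \<Rightarrow> real) \<Rightarrow> real \<Rightarrow> bool" where
  "has_tilted_law N Z M X \<theta> \<longleftrightarrow>
     prob_space N \<and> Z \<in> borel_measurable N \<and> laplace M X (- \<theta>) < \<infinity> \<and>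
     cdf (distr N borel Z) = tilted_cdf M X \<theta>"

text \<open>The condition \<open>Z \<sim> F\<^sub>\<theta>\<close> is satisfiable whenever the normalising constant is finite.\<close>

lemma tilted_law_exists:
  assumes "prob_space M" "X \<in> borel_measurable M" "laplace M X (- \<theta>) < \<infinity>"
  shows "has_tilted_law (density (distr M borel X) (\<lambda>t. ennreal (exp (\<theta> * t) / enn2real (laplace M X (- \<theta>))))) (\<lambda>t. t) M X \<theta>"
proof -
  interpret prob_space M by fact
  let ?D = "distr M borel X" and ?L = "enn2real (laplace M X (- \<theta>))"
  let ?f = "\<lambda>t. exp (\<theta> * t) / ?L"
  let ?N = "density ?D (\<lambda>t. ennreal (?f t))"
  note [measurable] = assms(2)
  have L: "laplace M X (-\<theta>) = (\<integral>\<^sup>+ t. ennreal (exp (\<theta> * t)) \<partial>?D)"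
    unfolding laplace_def by (subst nn_integral_distr) auto
  have "laplace M X (-\<theta>) \<noteq> 0"
    unfolding laplace_def by (subst nn_integral_0_iff_AE) (auto simp: ennreal_eq_0_iff not_le[symmetric] AE_False)
  hence pos: "?L > 0" using assms(3) by (simp add: enn2real_positive_iff zero_less_iff_neq_zero)
  have Leq: "ennreal ?L = laplace M X (-\<theta>)" using assms(3) by simp
  have *: "ennreal (?f t) = ennreal (exp (\<theta> * t)) / ennreal ?L" for t
    using pos by (simp add: divide_ennreal)
  have "(\<integral>\<^sup>+ t. ennreal (?f t) \<partial>?D) = (\<integral>\<^sup>+ t. ennreal (exp (\<theta> * t)) \<partial>?D) / ennreal ?L"
    unfolding * by (rule nn_integral_divide) auto
  also have "\<dots> = 1" using Leq L pos by (metis ennreal_divide_self ennreal_less_top ennreal_eq_0_iff not_le)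
  finally have one: "(\<integral>\<^sup>+ t. ennreal (?f t) \<partial>?D) = 1" .
  interpret N: prob_space ?N
    by (rule prob_spaceI) (use one in \<open>simp add: emeasure_density\<close>)
  have "cdf (distr ?N borel (\<lambda>t. t)) x = tilted_cdf M X \<theta> x" for x
  proof -
    have "distr ?N borel (\<lambda>t. t) = ?N"
      by (rule distr_id2) auto
    hence "cdf (distr ?N borel (\<lambda>t. t)) x = enn2real (\<integral>\<^sup>+ t. ennreal (?f t) * indicator {..x} t \<partial>?D)"
      by (simp add: cdf_def measure_def emeasure_density)
    also have "\<dots> = enn2real (\<integral>\<^sup>+ t. ennreal (indicator {..x} t *\<^sub>R ?f t) \<partial>?D)"
      by (intro arg_cong[where f=enn2real] nn_integral_cong) (auto split: split_indicator)
    also have "\<dots> = tilted_cdf M X \<theta> x"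
      unfolding tilted_cdf_def set_lebesgue_integral_def
      by (rule integral_eq_nn_integral[symmetric]) (use pos in auto)
    finally show ?thesis .
  qed
  thus ?thesis unfolding has_tilted_law_def
    using N.prob_space_axioms assms by auto
qed

lemma tilted_cdf_0: "prob_space M \<Longrightarrow> X \<in> borel_measurable M \<Longrightarrow> tilted_cdf M X 0 x = cdf (distr M borel X) x"
  by (simp add: tilted_cdf_def laplace_def prob_space.emeasure_space_1 cdf_def set_lebesgue_integral_def)

end

theory Submission
  imports Defs
begin

text \<open>For \<open>q > 1\<close> and \<open>a < b\<close> the gap \<open>(b\<^sup>q - a\<^sup>q) \<bar>x\<bar>\<^sup>q\<close> dominates any linear function of \<open>x\<close> up to a
  constant. Hence finiteness of \<open>\<integral> exp (\<theta> X + b\<^sup>q \<bar>X\<bar>\<^sup>q)\<close> for one \<open>\<theta>\<close> implies finiteness of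
  \<open>\<integral> exp (\<theta>' X + a\<^sup>q \<bar>X\<bar>\<^sup>q)\<close> for every \<open>\<theta>'\<close>: tilting can be added or removed at the price of an
  arbitrarily small decrease of the parameter. For \<open>q = 1\<close> the price is a decrease by \<open>\<bar>\<theta>\<bar>\<close>,
  which is harmless when all parameters are admissible.\<close>

text \<open>One family covers all finiteness conditions: up to the normalising constant it is the
  Weibull moment of the tilted law, \<open>\<theta> = 0\<close> gives that of \<open>X\<close>, and
  \<open>l = 0\<close> gives the Laplace transform because \<open>0 powr q = 0\<close>.\<close>

definition tilted_moment :: "'a measure \<Rightarrow> real \<Rightarrow> ('a \<Rightarrow> real) \<Rightarrow> real \<Rightarrow> real \<Rightarrow> ennreal" where
  "tilted_moment M q X \<theta> l = (\<integral>\<^sup>+ \<omega>. ennreal (exp (\<theta> * X \<omega> + l powr q * \<bar>X \<omega>\<bar> powr q)) \<partial>M)"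

lemma tilted_moment_0_left: "tilted_moment M q X 0 l = weibull_moment M q X l"
  by (simp add: tilted_moment_def weibull_moment_def)

lemma tilted_moment_0_right: "tilted_moment M q X \<theta> 0 = laplace M X (- \<theta>)"
  by (simp add: tilted_moment_def laplace_def)

text \<open>\<open>has_tilted_law\<close> fixes only a distribution function. This determines a
  probability measure on the real line, so the law of \<open>Z\<close> must be the density from
  \<open>tilted_law_exists\<close>.\<close>

lemma distr_tilted_law:
  assumes "prob_space M" and "X \<in> borel_measurable M" and N: "has_tilted_law N Z M X \<theta>"
  shows "distr N borel Z = density (distr M borel X)
           (\<lambda>t. ennreal (exp (\<theta> * t) / enn2real (laplace M X (- \<theta>))))" (is "_ = ?D")
proof -
  have Z: "prob_space N" "Z \<in> borel_measurable N" and fin: "laplace M X (- \<theta>) < \<infinity>"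
    and cdf: "cdf (distr N borel Z) = tilted_cdf M X \<theta>"
    using N by (auto simp: has_tilted_law_def)
  have D: "prob_space ?D" "cdf (distr ?D borel (\<lambda>t. t)) = tilted_cdf M X \<theta>"
    using tilted_law_exists[OF assms(1,2) fin] by (auto simp: has_tilted_law_def)
  have id: "distr ?D borel (\<lambda>t. t) = ?D"
    by (rule distr_id2) auto
  have "real_distribution ?D"
    using D(1) by (simp add: real_distribution_def real_distribution_axioms_def)
  moreover have "real_distribution (distr N borel Z)"
    using prob_space.prob_space_distr[OF Z]
    by (simp add: real_distribution_def real_distribution_axioms_def)
  ultimately show ?thesis
    using cdf D(2) id by (intro cdf_unique) auto
qed

text \<open>The moment depends on \<open>Z\<close> only through its law, so it can be pulled back to
  \<open>M\<close>, where density and integrand merge into a single exponential.\<close>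

lemma weibull_moment_tilted_law:
  assumes "prob_space M" and X [measurable]: "X \<in> borel_measurable M"
    and N: "has_tilted_law N Z M X \<theta>"
  shows "weibull_moment N q Z l
           = ennreal (1 / enn2real (laplace M X (- \<theta>))) * tilted_moment M q X \<theta> l"
proof -
  let ?L = "enn2real (laplace M X (- \<theta>))"
  have [measurable]: "Z \<in> borel_measurable N"
    using N by (simp add: has_tilted_law_def)
  have "weibull_moment N q Z l = (\<integral>\<^sup>+ t. ennreal (exp (l powr q * \<bar>t\<bar> powr q)) \<partial>distr N borel Z)"
    by (simp add: weibull_moment_def nn_integral_distr)
  also have "\<dots> = (\<integral>\<^sup>+ \<omega>. ennreal (exp (\<theta> * X \<omega>) / ?L) * ennreal (exp (l powr q * \<bar>X \<omega>\<bar> powr q)) \<partial>M)"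
    by (simp add: distr_tilted_law[OF assms] nn_integral_density nn_integral_distr)
  also have "\<dots> = (\<integral>\<^sup>+ \<omega>. ennreal (1 / ?L) * ennreal (exp (\<theta> * X \<omega> + l powr q * \<bar>X \<omega>\<bar> powr q)) \<partial>M)"
    by (intro nn_integral_cong) (simp add: exp_add flip: ennreal_mult)
  also have "\<dots> = ennreal (1 / ?L) * tilted_moment M q X \<theta> l"
    unfolding tilted_moment_def by (rule nn_integral_cmult) simp
  finally show ?thesis .
qed

lemma laplace_pos:
  assumes "prob_space M" and "X \<in> borel_measurable M"
  shows "laplace M X t > 0"
proof -
  interpret prob_space M by fact
  have "laplace M X t \<noteq> 0"
    unfolding laplace_def using assms(2)
    by (subst nn_integral_0_iff_AE) (auto simp: ennreal_eq_0_iff not_le[symmetric] AE_False)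
  thus ?thesis
    by (simp add: zero_less_iff_neq_zero)
qed

lemma weibull_moment_tilted_law_finite_iff:
  assumes "prob_space M" and "X \<in> borel_measurable M" and N: "has_tilted_law N Z M X \<theta>"
  shows "weibull_moment N q Z l < \<infinity> \<longleftrightarrow> tilted_moment M q X \<theta> l < \<infinity>"
proof -
  \<comment> \<open>Since \<open>1 / 0 = 0\<close> and \<open>0 * \<infinity> = 0\<close>, a
    vanishing constant would make the product finite in any case; positivity rules this out.\<close>
  have "enn2real (laplace M X (- \<theta>)) > 0"
    using laplace_pos[OF assms(1,2), of "- \<theta>"] N
    by (simp add: has_tilted_law_def enn2real_positive_iff)
  thus ?thesis
    by (auto simp: weibull_moment_tilted_law[OF assms] ennreal_mult_less_top ennreal_eq_0_iff)
qed

text \<open>A bound between the exponents that is uniform in \<open>x\<close> becomes a factor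
  \<open>exp C\<close> between the integrals.\<close>

lemma tilted_moment_finite_mono:
  assumes X [measurable]: "X \<in> borel_measurable M"
    and le: "\<And>x. \<theta>' * x + a powr q * \<bar>x\<bar> powr q \<le> C + (\<theta> * x + b powr q * \<bar>x\<bar> powr q)"
    and fin: "tilted_moment M q X \<theta> b < \<infinity>"
  shows "tilted_moment M q X \<theta>' a < \<infinity>"
proof -
  have "tilted_moment M q X \<theta>' a
      \<le> (\<integral>\<^sup>+ \<omega>. ennreal (exp C) * ennreal (exp (\<theta> * X \<omega> + b powr q * \<bar>X \<omega>\<bar> powr q)) \<partial>M)"
    unfolding tilted_moment_def
    by (intro nn_integral_mono) (simp add: le flip: ennreal_mult exp_add)
  also have "\<dots> = ennreal (exp C) * tilted_moment M q X \<theta> b"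
    unfolding tilted_moment_def by (rule nn_integral_cmult) simp
  also have "\<dots> < \<infinity>"
    using fin by (simp add: ennreal_mult_less_top)
  finally show ?thesis .
qed

text \<open>For \<open>d > 0\<close> the two terms in \<open>\<bar>x\<bar>\<close> agree at the
  threshold \<open>(d / c) powr (1 / (q - 1))\<close>. Below it the linear term is at most its value
  there; beyond it the power term dominates.\<close>

lemma linear_le_powr:
  fixes c d q x :: real
  assumes "q > 1" "c > 0" "d \<ge> 0"
  shows "d * \<bar>x\<bar> \<le> d * (d / c) powr (1 / (q - 1)) + c * \<bar>x\<bar> powr q"
proof (cases "\<bar>x\<bar> \<le> (d / c) powr (1 / (q - 1))")
  case True
  hence "d * \<bar>x\<bar> \<le> d * (d / c) powr (1 / (q - 1))"
    using assms by (intro mult_left_mono) auto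
  thus ?thesis
    using assms by (simp add: add_increasing2)
next
  case False
  hence "((d / c) powr (1 / (q - 1))) powr (q - 1) \<le> \<bar>x\<bar> powr (q - 1)"
    using assms by (intro powr_mono2) auto
  hence "d / c \<le> \<bar>x\<bar> powr (q - 1)"
    using assms by (simp add: powr_powr)
  hence "d \<le> c * \<bar>x\<bar> powr (q - 1)"
    using assms by (simp add: field_simps)
  hence "d * \<bar>x\<bar> \<le> c * \<bar>x\<bar> powr (q - 1) * \<bar>x\<bar>"
    by (intro mult_right_mono) auto
  also have "\<bar>x\<bar> powr (q - 1) * \<bar>x\<bar> = \<bar>x\<bar> powr q"
    by (cases "x = 0") (auto simp: powr_diff)
  hence "c * \<bar>x\<bar> powr (q - 1) * \<bar>x\<bar> = c * \<bar>x\<bar> powr q"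
    by (simp add: mult.assoc)
  finally show ?thesis
    using assms by (simp add: add_increasing)
qed

lemma tilted_moment_change_tilt:
  assumes X: "X \<in> borel_measurable M" and q: "q > 1" and ab: "0 \<le> a" "a < b"
    and fin: "tilted_moment M q X \<theta> b < \<infinity>"
  shows "tilted_moment M q X \<theta>' a < \<infinity>"
proof -
  define c where "c = b powr q - a powr q"
  \<comment> \<open>This is the constant of \<open>linear_le_powr\<close> for the slope
    \<open>d = \<bar>\<theta>' - \<theta>\<bar>\<close>.\<close>
  define C where "C = \<bar>\<theta>' - \<theta>\<bar> * (\<bar>\<theta>' - \<theta>\<bar> / c) powr (1 / (q - 1))"
  have c: "c > 0"
    using ab q by (simp add: c_def powr_less_mono2)
  have "\<theta>' * x + a powr q * \<bar>x\<bar> powr q \<le> C + (\<theta> * x + b powr q * \<bar>x\<bar> powr q)" for x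
  proof -
    have "(\<theta>' - \<theta>) * x \<le> \<bar>\<theta>' - \<theta>\<bar> * \<bar>x\<bar>"
      by (metis abs_ge_self abs_mult)
    also have "\<dots> \<le> C + c * \<bar>x\<bar> powr q"
      unfolding C_def using q c by (intro linear_le_powr) auto
    finally show ?thesis
      by (simp add: c_def algebra_simps)
  qed
  from tilted_moment_finite_mono[OF X this fin] show ?thesis .
qed

lemma tilted_moment_finite_if_strictly_subweibull:
  assumes X: "X \<in> borel_measurable M" and q: "q \<ge> 1" and S: "strictly_subweibull M q X"
    and a: "0 \<le> a"
  shows "tilted_moment M q X \<theta> a < \<infinity>"
proof (cases "q = 1")
  case True
  \<comment> \<open>The summand \<open>\<bar>\<theta>\<bar>\<close> absorbs the tilt; the summand 1
    keeps the parameter positive even if \<open>a\<close> and \<open>\<theta>\<close> are 0.\<close>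
  have "tilted_moment M q X 0 (a + \<bar>\<theta>\<bar> + 1) < \<infinity>"
    using S a by (simp add: strictly_subweibull_def tilted_moment_0_left)
  moreover have "\<theta> * x + a powr q * \<bar>x\<bar> powr q
      \<le> 0 + (0 * x + (a + \<bar>\<theta>\<bar> + 1) powr q * \<bar>x\<bar> powr q)" for x
  proof -
    have "\<theta> * x \<le> \<bar>\<theta>\<bar> * \<bar>x\<bar>"
      by (metis abs_ge_self abs_mult)
    thus ?thesis
      using True a by (simp add: algebra_simps)
  qed
  ultimately show ?thesis
    using tilted_moment_finite_mono[OF X] by blast
next
  case False
  have "tilted_moment M q X 0 (a + 1) < \<infinity>"
    using S a by (simp add: strictly_subweibull_def tilted_moment_0_left)
  thus ?thesis
    using tilted_moment_change_tilt[OF X, of q a "a + 1" 0 \<theta>] False q a by simp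
qed

lemma laplace_finite_if_subweibull:
  assumes "X \<in> borel_measurable M" and "q > 1" and "subweibull M q X"
  shows "laplace M X (- \<theta>) < \<infinity>"
proof -
  obtain l where "l > 0" "tilted_moment M q X 0 l < \<infinity>"
    using assms(3) by (auto simp: subweibull_def tilted_moment_0_left)
  hence "tilted_moment M q X \<theta> 0 < \<infinity>"
    using assms by (intro tilted_moment_change_tilt[where a = 0 and b = l]) auto
  thus ?thesis
    by (simp add: tilted_moment_0_right)
qed

text \<open>A supremum does not notice an arbitrarily small loss: everything strictly below an
  admissible \<open>b\<close> is bounded by the right-hand side, and the order of
  \<open>ennreal\<close> is dense.\<close>

lemma Sup_ennreal_le_if_interlaced:
  assumes "\<And>a b. 0 < a \<Longrightarrow> a < b \<Longrightarrow> P b \<Longrightarrow> Q a"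
  shows "Sup {ennreal l | l. l > 0 \<and> P l} \<le> Sup {ennreal l | l. l > 0 \<and> Q l}" (is "_ \<le> ?S")
proof (rule Sup_least, clarify)
  fix b :: real
  assume b: "0 < b" "P b"
  show "ennreal b \<le> ?S"
  proof (rule dense_le)
    fix z
    assume z: "z < ennreal b"
    then obtain a where a: "z = ennreal a" "0 \<le> a"
      by (cases z) auto
    show "z \<le> ?S"
    \<comment> \<open>The sets contain positive parameters only, so 0 is bounded directly instead of
      by membership.\<close>
    proof (cases "a = 0")
      case False
      hence "0 < a" "a < b"
        using a z by (auto simp: ennreal_less_iff)
      hence "Q a"
        using assms b by blast
      thus ?thesis
        using a \<open>0 < a\<close> by (intro Sup_upper) auto
    qed (simp add: a)
  qed
qed

lemma weibull_radius_eq_if_interlaced: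
  assumes "\<And>a b. 0 < a \<Longrightarrow> a < b \<Longrightarrow> weibull_moment N q Z b < \<infinity> \<Longrightarrow> weibull_moment M q X a < \<infinity>"
    and "\<And>a b. 0 < a \<Longrightarrow> a < b \<Longrightarrow> weibull_moment M q X b < \<infinity> \<Longrightarrow> weibull_moment N q Z a < \<infinity>"
  shows "weibull_radius N q Z = weibull_radius M q X"
  unfolding weibull_radius_def
  by (rule antisym; rule Sup_ennreal_le_if_interlaced; erule (2) assms)

lemma subweibull_if_interlaced:
  assumes "\<And>a b. 0 < a \<Longrightarrow> a < b \<Longrightarrow> weibull_moment M q X b < \<infinity> \<Longrightarrow> weibull_moment N q Z a < \<infinity>"
    and "subweibull M q X"
  shows "subweibull N q Z"
proof -
  obtain b where "0 < b" "weibull_moment M q X b < \<infinity>"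
    using assms(2) by (auto simp: subweibull_def)
  \<comment> \<open>Any point strictly between 0 and \<open>b\<close> would do.\<close>
  hence "weibull_moment N q Z (b / 2) < \<infinity>"
    by (intro assms(1)[of "b / 2" b]) auto
  thus ?thesis
    using \<open>0 < b\<close> unfolding subweibull_def by (intro exI[of _ "b / 2"]) auto
qed

theorem theorem4p1:
  fixes M :: "'a measure" and X :: "'a \<Rightarrow> real" and \<theta> :: real
  assumes "prob_space M" and "X \<in> borel_measurable M"
  shows "(\<forall>q>1. subweibull M q X \<longrightarrow>
            laplace M X (- \<theta>) < \<infinity> \<and>
            (\<forall>(N :: 'b measure) Z. has_tilted_law N Z M X \<theta> \<longrightarrow>
               subweibull N q Z \<and> weibull_radius N q Z = weibull_radius M q X)) \<and>
         (\<forall>q\<ge>1. strictly_subweibull M q X \<longrightarrow>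
            laplace M X (- \<theta>) < \<infinity> \<and>
            (\<forall>(N :: 'b measure) Z. has_tilted_law N Z M X \<theta> \<longrightarrow> strictly_subweibull N q Z)) \<and>
         (\<forall>q>1. \<not> subweibull M q X \<longrightarrow> laplace M X (- \<theta>) < \<infinity> \<longrightarrow>
            (\<forall>(N :: 'b measure) Z. has_tilted_law N Z M X \<theta> \<longrightarrow> \<not> subweibull N q Z))"
proof -
  \<comment> \<open>Moments of \<open>Z\<close> are moments of \<open>X\<close> with tilt
    \<open>\<theta>\<close>, so this changes the tilt from \<open>\<theta>\<close> to 0, and
    \<open>tilt\<close> below changes it back.\<close>
  have untilt: "weibull_moment M q X a < \<infinity>"
    if "has_tilted_law N Z M X \<theta>" "q > 1" "0 < a" "a < b" "weibull_moment N q Z b < \<infinity>"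
    for N :: "'b measure" and Z q a b
    using tilted_moment_change_tilt[of X M q a b \<theta> 0] that assms(2)
    unfolding weibull_moment_tilted_law_finite_iff[OF assms that(1)] tilted_moment_0_left by simp
  have tilt: "weibull_moment N q Z a < \<infinity>"
    if "has_tilted_law N Z M X \<theta>" "q > 1" "0 < a" "a < b" "weibull_moment M q X b < \<infinity>"
    for N :: "'b measure" and Z q a b
    using tilted_moment_change_tilt[of X M q a b 0 \<theta>] that assms(2)
    unfolding weibull_moment_tilted_law_finite_iff[OF assms that(1)] tilted_moment_0_left by simp
  have "subweibull N q Z \<and> weibull_radius N q Z = weibull_radius M q X"
    if "q > 1" "subweibull M q X" "has_tilted_law N Z M X \<theta>" for q Z and N :: "'b measure"
  proof
    show "subweibull N q Z"
      using that(2) by (rule subweibull_if_interlaced[rotated]) (rule tilt[OF that(3,1)])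
    show "weibull_radius N q Z = weibull_radius M q X"
      by (rule weibull_radius_eq_if_interlaced; erule (2) untilt[OF that(3,1)] tilt[OF that(3,1)])
  qed
  moreover have "laplace M X (- \<theta>) < \<infinity>" if "q \<ge> 1" "strictly_subweibull M q X" for q
    using tilted_moment_finite_if_strictly_subweibull[OF assms(2) that, of 0 \<theta>]
    by (simp add: tilted_moment_0_right)
  moreover have "strictly_subweibull N q Z"
    if "q \<ge> 1" "strictly_subweibull M q X" "has_tilted_law N Z M X \<theta>" for q Z and N :: "'b measure"
    using tilted_moment_finite_if_strictly_subweibull[OF assms(2) that(1,2), of _ \<theta>]
    unfolding strictly_subweibull_def weibull_moment_tilted_law_finite_iff[OF assms that(3)]
    by simp
  moreover have "\<not> subweibull N q Z"
    if "q > 1" "\<not> subweibull M q X" "has_tilted_law N Z M X \<theta>" for q Z and N :: "'b measure"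
    \<comment> \<open>If \<open>Z\<close> were subweibull, undoing the tilt would make
      \<open>X\<close> subweibull.\<close>
    using that(2) by (rule contrapos_nn) (erule subweibull_if_interlaced[rotated], rule untilt[OF that(3,1)])
  ultimately show ?thesis
    using laplace_finite_if_subweibull[OF assms(2)] by blast
qed

end
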